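(* Let $k\ge 3$ and $\ell$ be integers, let $v=k^2-k+2\ell$, and suppose that there exists a $(v,k)$-modular Golomb ruler. Then the following hold. 1. If $v\equiv 0 \pmod 8$, then there exist integers $i\in\{0,1,\dots,\ell-1\}$ and $j\in\{0,1,\dots,\ell-1-i\}$ such that $k-2\ell+4i$ is a perfect square and $k-2\ell+2i+4j$ is a sum of two squares. 2. If $v\equiv 4 \pmod 8$, then there exist integers $i\in\{0,1,\dots,\ell-1\}$ and $j\in\{0,1,\dots,\ell-1-i\}$ such that $k-2\ell+4i$ is a perfect square and $k-2\ell+2i+4j+2$ is a sum of two squares.
   Context: For an integer $k\ge 3$ and a positive integer $v$, a $(v,k)$-modular Golomb ruler ($(v,k)$-MGR) is a set of $k$ distinct integers $0 \leq x_1 < x_2 < \cdots < x_k \leq v-1$ such that all the differences $x_j - x_i \bmod v$ (over ordered pairs $(i,j)$ with $i \neq j$) are distinct elements of $\mathbb{Z}_v$. Squares are squares of integers ($0$ allowed). *)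

theory Defs
  imports "HOL-Number_Theory.Cong" "HOL-Computational_Algebra.Nth_Powers"
begin

text \<open>
  Elements of the integers modulo \<open>v\<close> are represented by their residues in \<open>{0..v - 1}\<close>;
  \<open>inj_on\<close> over the off-diagonal pairs says that the differences of distinct ordered pairs
  are distinct modulo \<open>v\<close>.
\<close>

definition modular_golomb_ruler :: "int \<Rightarrow> nat \<Rightarrow> int set \<Rightarrow> bool" where
  "modular_golomb_ruler v k X \<longleftrightarrow>
     3 \<le> k \<and> 0 < v \<and> X \<subseteq> {0..v - 1} \<and> card X = k \<and>
     inj_on (\<lambda>(x, y). (y - x) mod v) {(x, y). x \<in> X \<and> y \<in> X \<and> x \<noteq> y}"

definition sum_of_two_squares :: "int \<Rightarrow> bool" where
  "sum_of_two_squares n \<longleftrightarrow> (\<exists>a b. n = a\<^sup>2 + b\<^sup>2)"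

end

theory Submission
  imports Defs
begin

text \<open>
  Let \<open>X\<close> be the ruler, let \<open>D\<close> be its set of differences modulo \<open>v\<close>, and suppose that
  \<open>v = 2 * h\<close> is even. The residues other than \<open>0\<close> that are not differences are closed under
  negation, and \<open>h\<close> is one of them: a representation of \<open>h\<close> as a difference could be reversed, so
  that \<open>h\<close> would occur twice. The remaining ones form pairs \<open>{d, v - d}\<close>; the set \<open>H\<close> of the
  representatives \<open>d < h\<close> therefore records them all. For every even function \<open>g\<close> of period \<open>v\<close>,
  the sum of \<open>g (y - x)\<close> over \<open>X \<times> X\<close> can then be written in terms of \<open>g 0\<close>, \<open>g h\<close>, the sum of
  \<open>g\<close> over a full period and the sum of \<open>g\<close> over \<open>H\<close> (\<open>ruler_correlation\<close>).

  This identity is used for the real parts of three characters of the integers modulo \<open>v\<close>, where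
  \<open>4\<close> divides \<open>v\<close>. The trivial character gives \<open>card H = l - 1\<close>. For \<open>(-1) ^ d\<close> the
  left-hand side is a square, and for \<open>\<i> ^ d\<close>, of real part \<open>quartic_re d\<close>, it is the squared
  modulus of a Gaussian integer, hence a sum of two squares; the sum over a full period vanishes in
  both cases. Take for \<open>i\<close> the number of odd elements of \<open>H\<close> and for \<open>j\<close> the number of elements
  congruent to \<open>2\<close> modulo \<open>4\<close>. Then \<open>(-1) ^ d\<close> sums to \<open>l - 1 - 2 * i\<close> over \<open>H\<close>, and
  \<open>quartic_re\<close> sums to \<open>l - 1 - i - 2 * j\<close>. The two residues of \<open>v\<close> modulo \<open>8\<close> differ only in the
  value \<open>quartic_re h\<close>, which is \<open>1\<close> or \<open>-1\<close>.
\<close>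

section \<open>Differences of a modular Golomb ruler\<close>

text \<open>The nonzero differences modulo \<open>v\<close>, as residues; by the ruler property each arises once.\<close>

definition ruler_differences :: "int \<Rightarrow> int set \<Rightarrow> int set" where
  "ruler_differences v X = (\<lambda>(x, y). (y - x) mod v) ` {(x, y). x \<in> X \<and> y \<in> X \<and> x \<noteq> y}"

text \<open>
  The residues strictly between \<open>0\<close> and \<open>v / 2\<close> that are not differences of \<open>X\<close>, for even \<open>v\<close>:
  one representative of each pair \<open>{d, v - d}\<close> of missing residues.
\<close>

definition missing_half :: "int \<Rightarrow> int set \<Rightarrow> int set" where
  "missing_half v X = {0<..<v div 2} - ruler_differences v X"

lemma ruler_differences_range:
  assumes "modular_golomb_ruler v k X"
  shows "ruler_differences v X \<subseteq> {0<..<v}"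
proof
  fix d assume "d \<in> ruler_differences v X"
  then obtain x y where xy: "x \<in> X" "y \<in> X" "x \<noteq> y" and d: "d = (y - x) mod v"
    by (auto simp: ruler_differences_def)
  have v: "0 < v" and "x \<in> {0..v - 1}" "y \<in> {0..v - 1}"
    using assms xy by (auto simp: modular_golomb_ruler_def)
  then have "x mod v = x" "y mod v = y" by simp_all
  then have "(y - x) mod v \<noteq> 0"
    using xy(3) by (metis mod_eq_dvd_iff dvd_eq_mod_eq_0)
  moreover have "0 \<le> d" "d < v" using v d by simp_all
  ultimately show "d \<in> {0<..<v}" using d by auto
qed

lemma ruler_differences_uminus:
  assumes "d \<in> ruler_differences v X"
  shows "(- d) mod v \<in> ruler_differences v X"
proof -
  obtain x y where xy: "x \<in> X" "y \<in> X" "x \<noteq> y" and d: "d = (y - x) mod v"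
    using assms by (auto simp: ruler_differences_def)
  have "(- d) mod v = (x - y) mod v"
    using d by (simp add: mod_minus_eq)
  then show ?thesis
    unfolding ruler_differences_def
    using xy by (intro image_eqI[where x = "(y, x)"]) auto
qed

lemma ruler_differences_reflect:
  assumes "modular_golomb_ruler v k X" "0 < d" "d < v"
  shows "v - d \<in> ruler_differences v X \<longleftrightarrow> d \<in> ruler_differences v X"
proof -
  have "(- e) mod v = v - e" if "0 < e" "e < v" for e
    using that by (simp add: zmod_zminus1_eq_if)
  from this[of d] this[of "v - d"] show ?thesis
    using assms(2,3) ruler_differences_uminus[of d v X] ruler_differences_uminus[of "v - d" v X]
    by auto
qed

lemma half_notin_ruler_differences:
  assumes ruler: "modular_golomb_ruler v k X" and v: "v = 2 * h"
  shows "h \<notin> ruler_differences v X"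
proof
  assume "h \<in> ruler_differences v X"
  then obtain x y where xy: "x \<in> X" "y \<in> X" "x \<noteq> y" and h: "h = (y - x) mod v"
    by (auto simp: ruler_differences_def)
  have "0 < h" using ruler v by (simp add: modular_golomb_ruler_def)
  have "(x - y) mod v = (- h) mod v"
    using h by (simp add: mod_minus_eq)
  also have "\<dots> = h"
    using \<open>0 < h\<close> v by (simp add: zmod_zminus1_eq_if)
  finally have "(\<lambda>(x, y). (y - x) mod v) (x, y) = (\<lambda>(x, y). (y - x) mod v) (y, x)"
    using h by simp
  moreover have "inj_on (\<lambda>(x, y). (y - x) mod v) {(x, y). x \<in> X \<and> y \<in> X \<and> x \<noteq> y}"
    using ruler by (simp add: modular_golomb_ruler_def)
  ultimately have "(x, y) = (y, x)"
    using xy by (elim inj_onD) auto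
  then show False using xy(3) by simp
qed

text \<open>
  The diagonal contributes \<open>k * g 0\<close>. Off the diagonal \<open>y - x\<close> runs once through the differences,
  that is, through a full period without \<open>0\<close>, \<open>h\<close>, the elements \<open>d\<close> of \<open>missing_half v X\<close> and
  their reflections \<open>v - d\<close>, where \<open>g (v - d) = g d\<close>.
\<close>

lemma ruler_correlation:
  fixes g :: "int \<Rightarrow> int"
  assumes ruler: "modular_golomb_ruler v k X" and v: "v = 2 * h"
    and periodic: "\<And>d. g (d mod v) = g d" and even: "\<And>d. g (- d) = g d"
  shows "(\<Sum>x\<in>X. \<Sum>y\<in>X. g (y - x)) =
    (int k - 1) * g 0 - g h + (\<Sum>d\<in>{0..<v}. g d) - 2 * (\<Sum>d\<in>missing_half v X. g d)"
proof -
  define P where "P = {(x, y). x \<in> X \<and> y \<in> X \<and> x \<noteq> y}"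
  define D where "D = ruler_differences v X"
  define H where "H = missing_half v X"
  define R where "R = (\<lambda>d. v - d) ` H"
  have v_pos: "0 < v" and card: "card X = k" and X: "X \<subseteq> {0..v - 1}"
    and inj: "inj_on (\<lambda>(x, y). (y - x) mod v) P"
    using ruler by (auto simp: modular_golomb_ruler_def P_def)
  have h_pos: "0 < h" using v_pos v by simp
  have finX: "finite X" using X finite_subset by blast
  have D_range: "D \<subseteq> {0<..<v}"
    unfolding D_def by (rule ruler_differences_range[OF ruler])
  then have finD: "finite D" using finite_subset by blast
  have H: "H = {0<..<h} - D" using v by (simp add: H_def D_def missing_half_def)
  then have finH: "finite H" by simp
  have finP: "finite P"
    using finX by (intro finite_subset[of P "X \<times> X"]) (auto simp: P_def)
  have D_sum: "(\<Sum>d\<in>D. g d) = (\<Sum>(x, y)\<in>P. g (y - x))"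
  proof -
    have "(\<Sum>d\<in>D. g d) = (\<Sum>p\<in>P. g ((\<lambda>(x, y). (y - x) mod v) p))"
      unfolding D_def ruler_differences_def P_def[symmetric] by (simp add: sum.reindex[OF inj])
    then show ?thesis by (simp add: case_prod_unfold periodic)
  qed
  have "X \<times> X = (\<lambda>x. (x, x)) ` X \<union> P" by (auto simp: P_def)
  moreover have "(\<lambda>x. (x, x)) ` X \<inter> P = {}" by (auto simp: P_def)
  moreover have "(\<Sum>(x, y)\<in>(\<lambda>x. (x, x)) ` X. g (y - x)) = int k * g 0"
    by (subst sum.reindex) (auto simp: inj_on_def card)
  ultimately have "(\<Sum>(x, y)\<in>X \<times> X. g (y - x)) = int k * g 0 + (\<Sum>d\<in>D. g d)"
    using finX finP by (simp add: sum.union_disjoint D_sum)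
  then have correlation: "(\<Sum>x\<in>X. \<Sum>y\<in>X. g (y - x)) = int k * g 0 + (\<Sum>d\<in>D. g d)"
    by (simp add: sum.cartesian_product)
  have R: "R = {h<..<v} - D"
  proof
    show "R \<subseteq> {h<..<v} - D"
      using ruler_differences_reflect[OF ruler] v by (auto simp: R_def H D_def)
    show "{h<..<v} - D \<subseteq> R"
    proof
      fix d assume d: "d \<in> {h<..<v} - D"
      then have "v - d \<in> H"
        using ruler_differences_reflect[OF ruler, of d] h_pos v by (auto simp: H D_def)
      then show "d \<in> R" unfolding R_def by (intro image_eqI[where x = "v - d"]) auto
    qed
  qed
  have g_reflect: "g (v - d) = g d" for d
    using periodic[of "v - d"] periodic[of "- d"] even[of d] by simp
  have R_sum: "(\<Sum>d\<in>R. g d) = (\<Sum>d\<in>H. g d)"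
    unfolding R_def by (subst sum.reindex) (auto simp: inj_on_def g_reflect)
  have "h \<notin> D" unfolding D_def by (rule half_notin_ruler_differences[OF ruler v])
  then have "{0..<v} = {0} \<union> ({h} \<union> (D \<union> (H \<union> R)))"
    using D_range h_pos v by (auto simp: H R)
  moreover have "0 \<notin> {h} \<union> (D \<union> (H \<union> R))" "h \<notin> D \<union> (H \<union> R)"
    "D \<inter> (H \<union> R) = {}" "H \<inter> R = {}"
    using \<open>h \<notin> D\<close> D_range h_pos by (auto simp: H R)
  moreover have "finite R" by (simp add: R_def finH)
  ultimately have "(\<Sum>d\<in>{0..<v}. g d) = g 0 + g h + (\<Sum>d\<in>D. g d) + 2 * (\<Sum>d\<in>H. g d)"
    using finD finH by (simp add: sum.union_disjoint R_sum)
  then show ?thesis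
    using correlation by (simp add: H_def algebra_simps)
qed

section \<open>Characters of order two and four\<close>

text \<open>
  The sign \<open>(-1) ^ d\<close> for integers \<open>d\<close>. Like the two functions below, it is defined by cases,
  so that negative exponents and complex numbers are avoided.
\<close>

definition parity_sign :: "int \<Rightarrow> int" where
  "parity_sign d = (if even d then 1 else -1)"

text \<open>The real part of \<open>\<i> ^ d\<close>.\<close>

definition quartic_re :: "int \<Rightarrow> int" where
  "quartic_re d = (if d mod 4 = 0 then 1 else if d mod 4 = 2 then -1 else 0)"

text \<open>The imaginary part of \<open>\<i> ^ d\<close>.\<close>

definition quartic_im :: "int \<Rightarrow> int" where
  "quartic_im d = (if d mod 4 = 1 then 1 else if d mod 4 = 3 then -1 else 0)"

lemma sum_period_4_eq_0:
  fixes g :: "int \<Rightarrow> int"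
  assumes "4 dvd v" "0 < v" and periodic: "\<And>d. g (d mod 4) = g d"
    and zero: "g 0 + g 1 + g 2 + g 3 = 0"
  shows "(\<Sum>d\<in>{0..<v}. g d) = 0"
proof -
  have *: "(\<Sum>d\<in>{0..<4 * int n}. g d) = 0" for n
  proof (induction n)
    case (Suc n)
    have "{0..<4 * int (Suc n)} =
        {0..<4 * int n} \<union> {4 * int n, 4 * int n + 1, 4 * int n + 2, 4 * int n + 3}"
      by auto
    moreover have "g (4 * int n + r) = g r" for r
      using periodic[of "4 * int n + r"] periodic[of r] by simp
    from this[of 0] this[of 1] this[of 2] this[of 3]
    have "(\<Sum>d\<in>{4 * int n, 4 * int n + 1, 4 * int n + 2, 4 * int n + 3}. g d) = 0"
      using zero by simp
    ultimately show ?case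
      using Suc.IH by (simp add: sum.union_disjoint)
  qed simp
  obtain m where m: "v = 4 * m" using assms(1) by blast
  then have "v = 4 * int (nat m)" using assms(2) by simp
  then show ?thesis using * by metis
qed

lemma parity_sign_diff: "parity_sign (y - x) = parity_sign x * parity_sign y"
  by (auto simp: parity_sign_def)

text \<open>This is the real part of \<open>\<i> ^ y\<close> times the conjugate of \<open>\<i> ^ x\<close>.\<close>

lemma quartic_re_diff:
  "quartic_re (y - x) = quartic_re x * quartic_re y + quartic_im x * quartic_im y"
proof -
  have diff: "(y - x) mod 4 = (y mod 4 - x mod 4) mod 4" by (simp only: mod_diff_eq)
  have "a mod 4 = 0 \<or> a mod 4 = 1 \<or> a mod 4 = 2 \<or> a mod 4 = 3" for a :: int
    by presburger
  from this[of x] this[of y] show ?thesis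
    unfolding quartic_re_def quartic_im_def diff by (elim disjE) simp_all
qed

lemma quartic_re_minus: "quartic_re (- d) = quartic_re d"
  using quartic_re_diff[of 0 d] by (simp add: quartic_re_def quartic_im_def)

lemma sum_parity_sign:
  assumes "finite A"
  shows "(\<Sum>d\<in>A. parity_sign d) = int (card A) - 2 * int (card {d\<in>A. odd d})"
proof -
  have "(\<Sum>d\<in>A. parity_sign d) = (\<Sum>d\<in>A. 1 - 2 * (if odd d then 1 else 0))"
    by (intro sum.cong) (auto simp: parity_sign_def)
  then show ?thesis
    using assms by (simp add: sum_subtractf sum.If_cases Int_def flip: sum_distrib_left)
qed

lemma sum_quartic_re:
  assumes "finite A"
  shows "(\<Sum>d\<in>A. quartic_re d) =
    int (card A) - int (card {d\<in>A. odd d}) - 2 * int (card {d\<in>A. d mod 4 = 2})"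
proof -
  have "quartic_re d = 1 - (if odd d then 1 else 0) - 2 * (if d mod 4 = 2 then 1 else 0)" for d
    unfolding quartic_re_def by presburger
  then show ?thesis
    using assms by (simp add: sum_subtractf sum.If_cases Int_def flip: sum_distrib_left)
qed

section \<open>Squares and sums of two squares from the character sums\<close>

theorem theorem3p11:
  fixes k :: nat and l v :: int
  assumes "3 \<le> k"
    and "v = (int k)\<^sup>2 - int k + 2 * l"
    and "\<exists>X. modular_golomb_ruler v k X"
  shows "([v = 0] (mod 8) \<longrightarrow>
           (\<exists>i\<in>{0..l - 1}. \<exists>j\<in>{0..l - 1 - i}.
              is_square (int k - 2 * l + 4 * i) \<and>
              sum_of_two_squares (int k - 2 * l + 2 * i + 4 * j))) \<and>
         ([v = 4] (mod 8) \<longrightarrow>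
           (\<exists>i\<in>{0..l - 1}. \<exists>j\<in>{0..l - 1 - i}.
              is_square (int k - 2 * l + 4 * i) \<and>
              sum_of_two_squares (int k - 2 * l + 2 * i + 4 * j + 2)))"
proof -
  obtain X where ruler: "modular_golomb_ruler v k X" using assms(3) by blast
  have v_pos: "0 < v" and card_X: "card X = k"
    using ruler by (auto simp: modular_golomb_ruler_def)
  define H where "H = missing_half v X"
  define h where "h = v div 2"
  define i where "i = int (card {d\<in>H. odd d})"
  define j where "j = int (card {d\<in>H. d mod 4 = 2})"
  have finH: "finite H" by (simp add: H_def missing_half_def)
  have "even v" using assms(2) by (simp add: power2_eq_square)
  then have v_h: "v = 2 * h" by (simp add: h_def)

  \<comment> \<open>The constant function counts the missing residues.\<close>
  have "int k * int k = int k - 2 + v - 2 * int (card H)"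
    using ruler_correlation[OF ruler v_h, of "\<lambda>_. 1"] v_pos card_X by (simp add: H_def)
  then have card_H: "int (card H) = l - 1"
    using assms(2) by (simp add: power2_eq_square)
  have "card {d\<in>H. odd d} + card {d\<in>H. d mod 4 = 2} \<le> card H"
  proof -
    have "{d\<in>H. odd d} \<inter> {d\<in>H. d mod 4 = 2} = {}" by auto presburger
    then have "card {d\<in>H. odd d} + card {d\<in>H. d mod 4 = 2} =
        card ({d\<in>H. odd d} \<union> {d\<in>H. d mod 4 = 2})"
      using finH by (simp add: card_Un_disjoint)
    also have "\<dots> \<le> card H" using finH by (intro card_mono) auto
    finally show ?thesis .
  qed
  then have i: "i \<in> {0..l - 1}" and j: "j \<in> {0..l - 1 - i}"
    using card_H by (auto simp: i_def j_def)

  have square: "is_square (int k - 2 * l + 4 * i)" if "4 dvd v"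
  proof -
    have "even h" using that v_h by presburger
    have "(\<Sum>x\<in>X. parity_sign x)\<^sup>2 = (\<Sum>x\<in>X. \<Sum>y\<in>X. parity_sign (y - x))"
      by (simp add: parity_sign_diff power2_eq_square sum_product)
    also have "\<dots> = (int k - 1) * parity_sign 0 - parity_sign h
        + (\<Sum>d\<in>{0..<v}. parity_sign d) - 2 * (\<Sum>d\<in>H. parity_sign d)"
      unfolding H_def
    proof (rule ruler_correlation[OF ruler v_h])
      show "parity_sign (d mod v) = parity_sign d" for d
        using \<open>even v\<close> by (simp add: parity_sign_def dvd_mod_iff)
    qed (simp add: parity_sign_def)
    also have "(\<Sum>d\<in>{0..<v}. parity_sign d) = 0"
    proof (rule sum_period_4_eq_0[OF that v_pos])
      show "parity_sign (d mod 4) = parity_sign d" for d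
        by (simp add: parity_sign_def dvd_mod_iff)
    qed (simp add: parity_sign_def)
    also have "(\<Sum>d\<in>H. parity_sign d) = l - 1 - 2 * i"
      using sum_parity_sign[OF finH] card_H by (simp add: i_def)
    finally have "int k - 2 * l + 4 * i = (\<Sum>x\<in>X. parity_sign x)\<^sup>2"
      using \<open>even h\<close> by (simp add: parity_sign_def)
    then show ?thesis by (auto simp: is_nth_power_def)
  qed

  have two_squares: "sum_of_two_squares (int k - 1 - quartic_re h - 2 * (l - 1 - i - 2 * j))"
    if "4 dvd v"
  proof -
    have "(\<Sum>x\<in>X. quartic_re x)\<^sup>2 + (\<Sum>x\<in>X. quartic_im x)\<^sup>2 =
        (\<Sum>x\<in>X. \<Sum>y\<in>X. quartic_re (y - x))"
      by (simp add: quartic_re_diff power2_eq_square sum_product sum.distrib)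
    also have "\<dots> = (int k - 1) * quartic_re 0 - quartic_re h
        + (\<Sum>d\<in>{0..<v}. quartic_re d) - 2 * (\<Sum>d\<in>H. quartic_re d)"
      unfolding H_def
    proof (rule ruler_correlation[OF ruler v_h])
      show "quartic_re (d mod v) = quartic_re d" for d
        using that by (simp add: quartic_re_def mod_mod_cancel)
    qed (rule quartic_re_minus)
    also have "(\<Sum>d\<in>{0..<v}. quartic_re d) = 0"
      by (rule sum_period_4_eq_0[OF that v_pos]) (simp_all add: quartic_re_def)
    also have "(\<Sum>d\<in>H. quartic_re d) = l - 1 - i - 2 * j"
      using sum_quartic_re[OF finH] card_H by (simp add: i_def j_def)
    finally show ?thesis
      unfolding sum_of_two_squares_def
      by (intro exI[of _ "\<Sum>x\<in>X. quartic_re x"] exI[of _ "\<Sum>x\<in>X. quartic_im x"])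
        (simp add: quartic_re_def)
  qed

  show ?thesis
  proof (intro conjI impI)
    assume "[v = 0] (mod 8)"
    then have "4 dvd v" "h mod 4 = 0"
      using v_h unfolding cong_def by presburger+
    then have "int k - 1 - quartic_re h - 2 * (l - 1 - i - 2 * j)
        = int k - 2 * l + 2 * i + 4 * j"
      by (simp add: quartic_re_def)
    then show "\<exists>i\<in>{0..l - 1}. \<exists>j\<in>{0..l - 1 - i}.
        is_square (int k - 2 * l + 4 * i) \<and>
        sum_of_two_squares (int k - 2 * l + 2 * i + 4 * j)"
      using i j square two_squares \<open>4 dvd v\<close> by metis
  next
    assume "[v = 4] (mod 8)"
    then have "v mod 8 = 4" by (simp add: cong_def)
    then have "4 dvd v" "h mod 4 = 2"
      using v_h by presburger+
    then have "int k - 1 - quartic_re h - 2 * (l - 1 - i - 2 * j)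
        = int k - 2 * l + 2 * i + 4 * j + 2"
      by (simp add: quartic_re_def)
    then show "\<exists>i\<in>{0..l - 1}. \<exists>j\<in>{0..l - 1 - i}.
        is_square (int k - 2 * l + 4 * i) \<and>
        sum_of_two_squares (int k - 2 * l + 2 * i + 4 * j + 2)"
      using i j square two_squares \<open>4 dvd v\<close> by metis
  qed
qed

end
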